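(* Let $k\ge1$ be an integer and $\lambda>0$. Let $\{D_f(t)\}_{t\ge0}$ be a Lévy subordinator with $\mathbb{E}[D_f^{\rho}(t)]<\infty$ for all $\rho>0$, and let $Q_f^{(1)}(t)=N^{(k)}(D_f(t))$, $t\ge0$, where $\{N^{(k)}(t)\}_{t\ge0}$ is the Poisson process of order $k$ with parameter $\lambda$, independent of $\{D_f(t)\}_{t\ge0}$. Let $0<s\le t<\infty$. Then: (i) $\mathbb{E}[Q_f^{(1)}(t)]=\frac{k(k+1)}{2}\lambda\,\mathbb{E}[D_f(t)]$; (ii) $\mathrm{Cov}[Q_f^{(1)}(s),Q_f^{(1)}(t)]=\frac{k(k+1)(2k+1)}{6}\lambda\,\mathbb{E}[D_f(s)]+\left(\frac{k(k+1)}{2}\lambda\right)^2\mathrm{Var}[D_f(s)]$.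
   Context: Poisson process of order $k$ (PPoK) with parameter $\lambda$: $N^{(k)}(t)=\sum_{i=0}^{N(t,k\lambda)}X_i$, where $\{N(t,k\lambda)\}_{t\ge0}$ is a Poisson process of rate $k\lambda$, $X_0\equiv 0$, and $\{X_i\}_{i\ge 1}$ are IID uniform on $\{1,2,\ldots,k\}$, independent of the Poisson process. Lévy subordinator: a non-decreasing Lévy process $\{D_f(t)\}_{t\ge 0}$ with $\mathbb{E}[e^{-sD_f(t)}]=e^{-tf(s)}$, where $f(s)=bs+\int_0^\infty(1-e^{-sx})\,\nu(dx)$, $s>0$, $b\ge 0$, and $\nu$ is a non-negative Lévy measure on the positive half-line with $\int_0^\infty (x\wedge 1)\,\nu(dx)<\infty$ and total mass $\infty$. $D_f^{\rho}(t)$ denotes $(D_f(t))^{\rho}$. *)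

theory Defs
  imports "HOL-Probability.Probability"
begin

definition (in prob_space) covariance :: "('a \<Rightarrow> real) \<Rightarrow> ('a \<Rightarrow> real) \<Rightarrow> real" where
  "covariance X Y = expectation (\<lambda>\<omega>. (X \<omega> - expectation X) * (Y \<omega> - expectation Y))"

text \<open>The library's \<open>indep_var\<close> forces both sides to have the same value type, so
  independence of two families is stated for the sigma-algebras they generate.\<close>

definition (in prob_space) generated_events ::
  "'b measure \<Rightarrow> 'i set \<Rightarrow> ('i \<Rightarrow> 'a \<Rightarrow> 'b) \<Rightarrow> 'a set set" where
  "generated_events S I X =
     sigma_sets (space M) (\<Union>i\<in>I. {X i -` A \<inter> space M | A. A \<in> sets S})"

definition (in prob_space) indep_families ::
  "'b measure \<Rightarrow> 'i set \<Rightarrow> ('i \<Rightarrow> 'a \<Rightarrow> 'b) \<Rightarrow> 'c measure \<Rightarrow> 'j set \<Rightarrow> ('j \<Rightarrow> 'a \<Rightarrow> 'c) \<Rightarrow> bool" where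
  "indep_families S I X T J Y \<longleftrightarrow> indep_set (generated_events S I X) (generated_events T J Y)"

text \<open>Processes are functions on all of \<^typ>\<open>real\<close>, of which only the values at times
  \<open>t \<ge> 0\<close> matter.\<close>

definition (in prob_space) indep_increments :: "(real \<Rightarrow> 'a \<Rightarrow> real) \<Rightarrow> bool" where
  "indep_increments X \<longleftrightarrow>
     (\<forall>n. \<forall>\<tau> :: nat \<Rightarrow> real. 0 \<le> \<tau> 0 \<and> mono \<tau> \<longrightarrow>
        indep_vars (\<lambda>_. borel) (\<lambda>i \<omega>. X (\<tau> (Suc i)) \<omega> - X (\<tau> i) \<omega>) {..<n})"

text \<open>Path regularity is required for every \<open>\<omega>\<close>, not just almost surely: on a possibly incomplete
  probability space this is what makes a process evaluated at a random time a random variable.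
  The subtraction on \<^typ>\<open>nat\<close> does not truncate, since paths are nondecreasing.\<close>

definition (in prob_space) poisson_process :: "real \<Rightarrow> (real \<Rightarrow> 'a \<Rightarrow> nat) \<Rightarrow> bool" where
  "poisson_process r N \<longleftrightarrow>
     (\<forall>t\<ge>0. random_variable (count_space UNIV) (N t)) \<and>
     (AE \<omega> in M. N 0 \<omega> = 0) \<and>
     indep_increments (\<lambda>t \<omega>. real (N t \<omega>)) \<and>
     (\<forall>s t. 0 \<le> s \<and> s < t \<longrightarrow>
        distr M (count_space UNIV) (\<lambda>\<omega>. N t \<omega> - N s \<omega>) = measure_pmf (poisson_pmf (r * (t - s)))) \<and>
     (\<forall>\<omega>\<in>space M. mono_on {0..} (\<lambda>t. N t \<omega>) \<and>
        (\<forall>t\<ge>0. continuous (at_right t) (\<lambda>u. real (N u \<omega>))))"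

definition (in prob_space) poisson_process_order ::
  "nat \<Rightarrow> real \<Rightarrow> (real \<Rightarrow> 'a \<Rightarrow> nat) \<Rightarrow> bool" where
  "poisson_process_order k l P \<longleftrightarrow>
     (\<exists>N X. poisson_process (real k * l) N \<and>
        (\<forall>\<omega>\<in>space M. X 0 \<omega> = (0::nat)) \<and>
        indep_vars (\<lambda>_. count_space UNIV) X {1..} \<and>
        (\<forall>i\<ge>1. distr M (count_space UNIV) (X i) = measure_pmf (pmf_of_set {1..k})) \<and>
        indep_families (count_space UNIV) {0..} N (count_space UNIV) {1..} X \<and>
        (\<forall>t\<ge>0. \<forall>\<omega>\<in>space M. P t \<omega> = (\<Sum>i=0..N t \<omega>. X i \<omega>)))"

definition (in prob_space) levy_process :: "(real \<Rightarrow> 'a \<Rightarrow> real) \<Rightarrow> bool" where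
  "levy_process D \<longleftrightarrow>
     (\<forall>t\<ge>0. random_variable borel (D t)) \<and>
     (AE \<omega> in M. D 0 \<omega> = 0) \<and>
     indep_increments D \<and>
     (\<forall>s\<ge>0. \<forall>h\<ge>0. distr M borel (\<lambda>\<omega>. D (s + h) \<omega> - D s \<omega>) = distr M borel (\<lambda>\<omega>. D h \<omega> - D 0 \<omega>)) \<and>
     (\<forall>t\<ge>0. \<forall>\<epsilon>>0.
        ((\<lambda>u. prob {\<omega>\<in>space M. \<bar>D u \<omega> - D t \<omega>\<bar> > \<epsilon>}) \<longlongrightarrow> 0) (at t within {0..})) \<and>
     (AE \<omega> in M. (\<forall>t\<ge>0. continuous (at_right t) (\<lambda>u. D u \<omega>)) \<and>
        (\<forall>t>0. \<exists>L. ((\<lambda>u. D u \<omega>) \<longlongrightarrow> L) (at_left t)))"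

text \<open>The measure lives on the Borel sets of the whole line and is concentrated on the open positive
  half-line.\<close>

definition subordinator_levy_measure :: "real measure \<Rightarrow> bool" where
  "subordinator_levy_measure \<nu> \<longleftrightarrow>
     sets \<nu> = sets borel \<and> emeasure \<nu> {..0} = 0 \<and>
     (\<integral>\<^sup>+x\<in>{0<..}. ennreal (min x 1) \<partial>\<nu>) < \<infinity> \<and>
     emeasure \<nu> {0<..} = \<infinity>"

text \<open>The state space is \<open>[0,\<infinity>)\<close> for every \<open>\<omega>\<close>, so that a subordinator can be used as
  a random time; the remaining path properties are almost sure.\<close>

definition (in prob_space) levy_subordinator ::
  "(real \<Rightarrow> real) \<Rightarrow> (real \<Rightarrow> 'a \<Rightarrow> real) \<Rightarrow> bool" where
  "levy_subordinator f D \<longleftrightarrow>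
     levy_process D \<and>
     (\<forall>t\<ge>0. \<forall>\<omega>\<in>space M. 0 \<le> D t \<omega>) \<and>
     (AE \<omega> in M. mono_on {0..} (\<lambda>t. D t \<omega>)) \<and>
     (\<exists>b \<nu>. 0 \<le> b \<and> subordinator_levy_measure \<nu> \<and>
        (\<forall>s>0. f s = b * s + (LINT x:{0<..}|\<nu>. 1 - exp (- s * x)))) \<and>
     (\<forall>t\<ge>0. \<forall>s>0. expectation (\<lambda>\<omega>. exp (- s * D t \<omega>)) = exp (- t * f s))"

definition time_changed :: "(real \<Rightarrow> 'a \<Rightarrow> nat) \<Rightarrow> (real \<Rightarrow> 'a \<Rightarrow> real) \<Rightarrow> real \<Rightarrow> 'a \<Rightarrow> real" where
  "time_changed P D t \<omega> = real (P (D t \<omega>) \<omega>)"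

end

theory Submission
  imports Defs
begin

text \<open>
  Independence of two \<open>\<sigma>\<close>-algebras \<open>F\<close> and \<open>G\<close> means that \<open>\<omega> \<mapsto> (\<omega>, \<omega>)\<close> pushes the probability
  measure forward to the product of its restrictions to \<open>F\<close> and \<open>G\<close>. Hence, by Tonelli, in an integral of
  \<open>h \<omega> \<omega>\<close> the \<open>G\<close>-measurable argument may be frozen while integrating over the \<open>F\<close>-measurable one.
  Freezing the Poisson process \<open>N\<close> against its jump sizes, and then the subordinator \<open>D\<close> against the process
  \<open>P\<close> of order \<open>k\<close>, reduces both claims to \<open>E P(u) = \<mu> u\<close> and
  \<open>E P(u) P(v) = \<sigma> min u v + \<mu>\<^sup>2 u v\<close>, with \<open>\<mu> = k (k + 1) l / 2\<close> and
  \<open>\<sigma> = k (k + 1) (2 k + 1) l / 6\<close>, together with \<open>Cov (D s) (D t) = Var (D s)\<close> for \<open>s \<le> t\<close>, which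
  holds because increments are independent.
\<close>

section \<open>Double sums and moments of the uniform and Poisson laws\<close>

text \<open>Because \<open>m \<le> n\<close>, each of the \<open>m\<close> rows meets the diagonal
  exactly once. With \<open>a\<close> a second moment and \<open>b\<close> a squared mean, this is
  the mean product of two partial sums of IID variables.\<close>

lemma sum_sum_diagonal:
  fixes a b :: real
  assumes "m \<le> n"
  shows "(\<Sum>i\<in>{1..m}. \<Sum>j\<in>{1..n}. if i = j then a else b)
           = (a - b) * real m + b * real m * real n"
proof -
  have "(\<Sum>j\<in>{1..n}. if i = j then a else b) = (a - b) + b * real n" if "i \<in> {1..m}" for i
  proof -
    have "(\<Sum>j\<in>{1..n}. if i = j then a else b) = (\<Sum>j\<in>{1..n}. (if i = j then a - b else 0) + b)"
      by (intro sum.cong) auto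
    also have "\<dots> = (a - b) + b * real n"
      using that assms by (subst sum.distrib) (simp add: sum.delta')
    finally show ?thesis .
  qed
  then have "(\<Sum>i\<in>{1..m}. \<Sum>j\<in>{1..n}. if i = j then a else b) = (\<Sum>i\<in>{1..m}. (a - b) + b * real n)"
    by (rule sum.cong[OF refl])
  also have "\<dots> = (a - b) * real m + b * real m * real n"
    by (simp add: algebra_simps)
  finally show ?thesis .
qed

lemma sum_of_squares_of_nat:
  "(\<Sum>i\<in>{1..k}. (real i)\<^sup>2) = real k * (real k + 1) * (2 * real k + 1) / 6"
  by (induction k) (auto simp: field_simps power2_eq_square)

lemma sum_of_nat:
  "(\<Sum>i\<in>{1..k}. real i) = real k * (real k + 1) / 2"
  by (induction k) (auto simp: field_simps)

text \<open>Moments are stated with \<open>has_bochner_integral\<close> throughout, so that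
  integrability and value travel together through the later calculations.\<close>

lemma
  assumes "k \<ge> 1"
  shows has_bochner_integral_uniform_pmf:
      "has_bochner_integral (measure_pmf (pmf_of_set {1..k})) real ((real k + 1) / 2)"
    and has_bochner_integral_uniform_pmf_square:
      "has_bochner_integral (measure_pmf (pmf_of_set {1..k})) (\<lambda>i. (real i)\<^sup>2)
         ((real k + 1) * (2 * real k + 1) / 6)"
  using assms sum_of_squares_of_nat[of k] sum_of_nat[of k]
  by (auto simp: has_bochner_integral_iff integral_pmf_of_set intro!: integrable_measure_pmf_finite)

text \<open>Nonnegativity turns the convergent series into a finite nonnegative integral, which
  yields integrability along with the value.\<close>

lemma has_bochner_integral_measure_pmf_sums:
  fixes p :: "nat pmf" and g :: "nat \<Rightarrow> real"
  assumes "\<And>n. 0 \<le> g n" "(\<lambda>n. pmf p n * g n) sums c"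
  shows "has_bochner_integral (measure_pmf p) g c"
proof (rule has_bochner_integral_nn_integral)
  show "0 \<le> c"
    using assms by (intro sums_le[OF _ sums_zero assms(2)]) simp
  have "(\<integral>\<^sup>+x. ennreal (g x) \<partial>measure_pmf p) = (\<integral>\<^sup>+x. ennreal (pmf p x * g x) \<partial>count_space UNIV)"
    using assms by (simp add: nn_integral_measure_pmf ennreal_mult)
  also have "\<dots> = (\<Sum>n. ennreal (pmf p n * g n))"
    by (rule nn_integral_count_space_nat)
  also have "\<dots> = ennreal c"
    using assms by (intro suminf_ennreal_eq) auto
  finally show "(\<integral>\<^sup>+x. ennreal (g x) \<partial>measure_pmf p) = ennreal c" .
qed (use assms in auto)

text \<open>With \<open>p n\<close> the Poisson weight,
  \<open>p (n + 1) * (n + 1) = r * p n\<close>. Hence the mean follows from the total mass, and the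
  second moment from the total mass and the mean.\<close>

lemma
  assumes "0 < r"
  shows has_bochner_integral_poisson_pmf:
      "has_bochner_integral (measure_pmf (poisson_pmf r)) real r"
    and has_bochner_integral_poisson_pmf_square:
      "has_bochner_integral (measure_pmf (poisson_pmf r)) (\<lambda>n. (real n)\<^sup>2) (r + r\<^sup>2)"
proof -
  have 0: "(\<lambda>n. r ^ n / fact n * exp (- r)) sums 1"
    using sums_mult2[OF exp_converges[of r], of "exp (- r)"]
    by (simp add: divide_inverse exp_minus_inverse mult_ac)
  have 1: "(\<lambda>n. r ^ n / fact n * exp (- r) * real n) sums r"
  proof -
    have "(\<lambda>n. r * (r ^ n / fact n * exp (- r))) sums r"
      using sums_mult[OF 0, of r] by simp
    also have "(\<lambda>n. r * (r ^ n / fact n * exp (- r)))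
        = (\<lambda>n. r ^ Suc n / fact (Suc n) * exp (- r) * real (Suc n))"
      by (simp add: fun_eq_iff divide_simps)
    \<comment> \<open>Undoing the index shift adds only the term at \<open>n = 0\<close>, which
      vanishes because of the factor \<open>real n\<close>.\<close>
    finally show ?thesis
      by (subst (asm) sums_Suc_iff) simp
  qed
  have 2: "(\<lambda>n. r ^ n / fact n * exp (- r) * (real n)\<^sup>2) sums (r + r\<^sup>2)"
  proof -
    have "(\<lambda>n. r * (r ^ n / fact n * exp (- r)) + r * (r ^ n / fact n * exp (- r) * real n))
            sums (r + r\<^sup>2)"
      using sums_add[OF sums_mult[OF 0, of r] sums_mult[OF 1, of r]] by (simp add: power2_eq_square)
    also have "(\<lambda>n. r * (r ^ n / fact n * exp (- r)) + r * (r ^ n / fact n * exp (- r) * real n))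
        = (\<lambda>n. r ^ Suc n / fact (Suc n) * exp (- r) * (real (Suc n))\<^sup>2)"
      by (simp add: fun_eq_iff divide_simps power2_eq_square) (simp add: algebra_simps)
    finally show ?thesis
      by (subst (asm) sums_Suc_iff) simp
  qed
  show "has_bochner_integral (measure_pmf (poisson_pmf r)) real r"
    "has_bochner_integral (measure_pmf (poisson_pmf r)) (\<lambda>n. (real n)\<^sup>2) (r + r\<^sup>2)"
    using 1 2 assms by (auto intro!: has_bochner_integral_measure_pmf_sums)
qed

section \<open>Mixed moments of a process with independent increments\<close>

text \<open>Write \<open>X u * X v\<close> as \<open>(X u)^2 + X u * (X v - X u)\<close>. Almost
  surely \<open>X u\<close> is the increment from 0 to \<open>u\<close>, so the last product has
  independent factors. This serves both the Poisson process and the subordinator.\<close>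

lemma (in prob_space) has_bochner_integral_indep_increments_mult:
  assumes "indep_increments X" "AE \<omega> in M. X 0 \<omega> = 0" "0 \<le> u" "u \<le> v"
    and rv: "\<And>w. 0 \<le> w \<Longrightarrow> random_variable borel (X w)"
    and hX: "has_bochner_integral M (X u) a" "has_bochner_integral M (X v) b"
    and sq: "has_bochner_integral M (\<lambda>\<omega>. (X u \<omega>)\<^sup>2) c"
  shows "has_bochner_integral M (\<lambda>\<omega>. X u \<omega> * X v \<omega>) (c + a * (b - a))"
proof -
  \<comment> \<open>The time grid is 0, \<open>u\<close>, \<open>v\<close>, \<open>v\<close>, and so
    on: a monotone sequence, as \<open>indep_increments\<close> demands, whose first two increments
    are the wanted ones.\<close>
  define \<tau> where "\<tau> n = (if n = 0 then 0 else if n = 1 then u else v)" for n :: nat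
  define Y where "Y i \<omega> = X (\<tau> (Suc i)) \<omega> - X (\<tau> i) \<omega>" for i \<omega>
  note [measurable] = rv[of 0] rv[OF \<open>0 \<le> u\<close>] rv[of v]
  have [simp]: "0 \<le> v" using assms by simp
  have "mono \<tau>"
    using assms by (auto simp: \<tau>_def mono_def)
  moreover have "0 \<le> \<tau> 0"
    by (simp add: \<tau>_def)
  ultimately have indep: "indep_vars (\<lambda>_. borel) Y {..<2}"
    using assms(1) unfolding indep_increments_def Y_def by blast
  have Y0: "Y 0 = (\<lambda>\<omega>. X u \<omega> - X 0 \<omega>)" and Y1: "Y 1 = (\<lambda>\<omega>. X v \<omega> - X u \<omega>)"
    by (auto simp: Y_def \<tau>_def fun_eq_iff)
  have two: "{..<2::nat} = {0, 1}" by auto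
  have AE0: "AE \<omega> in M. Y 0 \<omega> = X u \<omega>"
    using assms(2) by eventually_elim (simp add: Y0)
  have i0: "has_bochner_integral M (Y 0) a"
    using hX(1) AE0 by (subst has_bochner_integral_cong_AE[of _ _ "X u"]) (auto simp: Y0 simp del: One_nat_def)
  have i1: "has_bochner_integral M (Y 1) (b - a)"
    using has_bochner_integral_diff[OF hX(2,1)] by (simp only: Y1)
  have int: "\<And>i. i \<in> {..<2} \<Longrightarrow> integrable M (Y i)"
    using i0 i1 by (auto simp: two has_bochner_integral_iff)
  have "has_bochner_integral M (\<lambda>\<omega>. Y 0 \<omega> * Y 1 \<omega>) (a * (b - a))"
    using indep_vars_lebesgue_integral[OF _ indep int] indep_vars_integrable[OF _ indep int] i0 i1
    by (simp add: has_bochner_integral_iff two)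
  also have "?this \<longleftrightarrow> has_bochner_integral M (\<lambda>\<omega>. X u \<omega> * (X v \<omega> - X u \<omega>)) (a * (b - a))"
    using AE0 by (intro has_bochner_integral_cong_AE) (auto simp: Y0 Y1 simp del: One_nat_def)
  finally have "has_bochner_integral M (\<lambda>\<omega>. (X u \<omega>)\<^sup>2 + X u \<omega> * (X v \<omega> - X u \<omega>)) (c + a * (b - a))"
    using sq by (intro has_bochner_integral_add)
  then show ?thesis
    by (simp add: algebra_simps power2_eq_square)
qed

section \<open>Freezing an independent argument; measurability at a random time\<close>

lemma (in prob_space) indep_set_commute:
  "indep_set A B \<longleftrightarrow> indep_set B A"
  unfolding indep_sets2_eq by (metis Int_commute mult.commute)

text \<open>Nonnegativity allows Tonelli, so integrability on the diagonal is a conclusion: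
  finiteness comes from the inner and outer integrals.\<close>

lemma (in prob_space) has_bochner_integral_freeze:
  fixes h :: "'a \<Rightarrow> 'a \<Rightarrow> real"
  assumes indep: "indep_set (sets F) (sets G)" and space: "space F = space M" "space G = space M"
    and h [measurable]: "(\<lambda>(\<omega>, \<omega>'). h \<omega> \<omega>') \<in> borel_measurable (F \<Otimes>\<^sub>M G)"
    and nonneg: "\<And>\<omega> \<omega>'. \<omega> \<in> space M \<Longrightarrow> \<omega>' \<in> space M \<Longrightarrow> 0 \<le> h \<omega> \<omega>'"
    and inner: "\<And>\<omega>'. \<omega>' \<in> space M \<Longrightarrow> has_bochner_integral M (\<lambda>\<omega>. h \<omega> \<omega>') (g \<omega>')"
    and outer: "has_bochner_integral M g c"
  shows "has_bochner_integral M (\<lambda>\<omega>. h \<omega> \<omega>) c"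
proof -
  have sub: "sets F \<subseteq> sets M" "sets G \<subseteq> sets M"
    using indep by (auto simp: indep_sets2_eq)
  have [measurable]: "(\<lambda>\<omega>. \<omega>) \<in> M \<rightarrow>\<^sub>M F" "(\<lambda>\<omega>. \<omega>) \<in> M \<rightarrow>\<^sub>M G"
    using sub space by (auto intro!: measurableI)
  have gen: "sigma_sets (space M) {(\<lambda>\<omega>. \<omega>) -` A \<inter> space M | A. A \<in> sets K} = sets K"
    if "space K = space M" for K :: "'a measure"
  proof -
    have "{(\<lambda>\<omega>. \<omega>) -` A \<inter> space M | A. A \<in> sets K} = sets K"
      using sets.sets_into_space[of _ K] that by (auto simp: Int_absorb2)
    then show ?thesis
      using sets.sigma_sets_eq[of K] that by simp
  qed
  \<comment> \<open>Identity maps have a common value type, as \<open>indep_var\<close> demands, whatever the two families are.\<close>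
  have "indep_var F (\<lambda>\<omega>. \<omega>) G (\<lambda>\<omega>. \<omega>)"
    unfolding indep_var_eq using indep gen[OF space(1)] gen[OF space(2)]
    by (metis \<open>(\<lambda>\<omega>. \<omega>) \<in> M \<rightarrow>\<^sub>M F\<close> \<open>(\<lambda>\<omega>. \<omega>) \<in> M \<rightarrow>\<^sub>M G\<close>)
  then have prod: "distr M F (\<lambda>\<omega>. \<omega>) \<Otimes>\<^sub>M distr M G (\<lambda>\<omega>. \<omega>) = distr M (F \<Otimes>\<^sub>M G) (\<lambda>\<omega>. (\<omega>, \<omega>))"
    by (simp add: indep_var_distribution_eq)
  interpret F: prob_space "distr M F (\<lambda>\<omega>. \<omega>)" by (rule prob_space_distr) simp
  interpret G: prob_space "distr M G (\<lambda>\<omega>. \<omega>)" by (rule prob_space_distr) simp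
  interpret FG: pair_sigma_finite "distr M F (\<lambda>\<omega>. \<omega>)" "distr M G (\<lambda>\<omega>. \<omega>)" ..
  have [measurable]: "h' \<in> borel_measurable (F \<Otimes>\<^sub>M G)" if "h' = (\<lambda>x. ennreal (h (fst x) (snd x)))" for h'
    using h unfolding that split_beta' by measurable
  have g0: "0 \<le> g \<omega>'" if "\<omega>' \<in> space M" for \<omega>'
    using inner[OF that] nonneg that
    by (metis has_bochner_integral_integral_eq Bochner_Integration.integral_nonneg)
  have c0: "0 \<le> c"
    using outer g0 by (metis has_bochner_integral_integral_eq Bochner_Integration.integral_nonneg)
  have meas: "(\<lambda>\<omega>. h \<omega> \<omega>) \<in> borel_measurable M"
    using measurable_compose[OF _ h, of "\<lambda>\<omega>. (\<omega>, \<omega>)" M] by simp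
  have "(\<integral>\<^sup>+\<omega>. ennreal (h \<omega> \<omega>) \<partial>M)
      = (\<integral>\<^sup>+x. ennreal (h (fst x) (snd x)) \<partial>distr M (F \<Otimes>\<^sub>M G) (\<lambda>\<omega>. (\<omega>, \<omega>)))"
    by (subst nn_integral_distr) auto
  \<comment> \<open>By independence the law of the diagonal map is the product law. The
    \<open>G\<close> coordinate goes outside and stays frozen while the \<open>F\<close> coordinate
    is integrated.\<close>
  also have "\<dots> = (\<integral>\<^sup>+\<omega>'. \<integral>\<^sup>+\<omega>. ennreal (h \<omega> \<omega>') \<partial>distr M F (\<lambda>\<omega>. \<omega>) \<partial>distr M G (\<lambda>\<omega>. \<omega>))"
    unfolding prod[symmetric] by (subst FG.nn_integral_snd[symmetric]) auto
  also have "\<dots> = (\<integral>\<^sup>+\<omega>'. \<integral>\<^sup>+\<omega>. ennreal (h \<omega> \<omega>') \<partial>distr M F (\<lambda>\<omega>. \<omega>) \<partial>M)"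
    by (subst nn_integral_distr) auto
  also have "\<dots> = (\<integral>\<^sup>+\<omega>'. \<integral>\<^sup>+\<omega>. ennreal (h \<omega> \<omega>') \<partial>M \<partial>M)"
  proof (intro nn_integral_cong)
    fix \<omega>' assume "\<omega>' \<in> space M"
    then have [measurable]: "\<omega>' \<in> space G" by (simp add: space)
    show "(\<integral>\<^sup>+\<omega>. ennreal (h \<omega> \<omega>') \<partial>distr M F (\<lambda>\<omega>. \<omega>)) = (\<integral>\<^sup>+\<omega>. ennreal (h \<omega> \<omega>') \<partial>M)"
      by (subst nn_integral_distr) auto
  qed
  also have "\<dots> = (\<integral>\<^sup>+\<omega>'. ennreal (g \<omega>') \<partial>M)"
    using inner nonneg
    by (intro nn_integral_cong) (auto simp: has_bochner_integral_iff nn_integral_eq_integral)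
  also have "\<dots> = ennreal c"
    using outer g0 by (auto simp: has_bochner_integral_iff nn_integral_eq_integral)
  finally show ?thesis
    using meas nonneg c0
    by (intro has_bochner_integral_nn_integral) auto
qed

text \<open>The random time is approximated from strictly above by multiples of \<open>1 / (n + 1)\<close>; a countable
  case distinction makes the approximants measurable.\<close>

lemma borel_measurable_right_continuous_time_change:
  fixes Y :: "real \<Rightarrow> 'a \<Rightarrow> real"
  assumes Y: "\<And>t. 0 \<le> t \<Longrightarrow> Y t \<in> borel_measurable A"
    and cont: "\<And>t \<omega>. \<omega> \<in> space A \<Longrightarrow> 0 \<le> t \<Longrightarrow> continuous (at_right t) (\<lambda>u. Y u \<omega>)"
    and T [measurable]: "T \<in> borel_measurable B"
    and T0: "\<And>\<omega>. \<omega> \<in> space B \<Longrightarrow> 0 \<le> T \<omega>"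
  shows "(\<lambda>(\<omega>, \<omega>'). Y (T \<omega>') \<omega>) \<in> borel_measurable (A \<Otimes>\<^sub>M B)"
proof -
  \<comment> \<open>The \<open>+ 1\<close> in the numerator keeps the approximant strictly above the
    time, at distance at most \<open>1 / (n + 1)\<close>. Strictness matters because
    \<open>at_right\<close> excludes the point itself.\<close>
  define d where "d n j = (real j + 1) / (real n + 1)" for n j :: nat
  define J where "J n x = nat \<lfloor>x * (real n + 1)\<rfloor>" for n and x :: real
  have d0: "0 \<le> d n j" for n j by (simp add: d_def)
  show ?thesis
  proof (rule borel_measurable_LIMSEQ_real[where u = "\<lambda>n p. Y (d n (J n (T (snd p)))) (fst p)"])
    fix p assume "p \<in> space (A \<Otimes>\<^sub>M B)"
    then have p: "fst p \<in> space A" "0 \<le> T (snd p)"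
      using T0 by (auto simp: space_pair_measure)
    define x where "x = T (snd p)"
    have lower: "x < d n (J n x)" and upper: "d n (J n x) \<le> x + 1 / (real n + 1)" for n
    proof -
      have "0 \<le> x * (real n + 1)" using p by (simp add: x_def)
      then have "x * (real n + 1) < real (J n x) + 1" "real (J n x) \<le> x * (real n + 1)"
        unfolding J_def by linarith+
      then show "x < d n (J n x)"
        by (simp add: d_def pos_less_divide_eq)
      show "d n (J n x) \<le> x + 1 / (real n + 1)"
        using \<open>real (J n x) \<le> _\<close>
        by (simp add: d_def add_divide_distrib[of "real _"] pos_divide_le_eq)
    qed
    have "(\<lambda>n. d n (J n x)) \<longlonglongrightarrow> x"
    proof (rule tendsto_sandwich[of "\<lambda>_. x"])
      show "(\<lambda>n. x + 1 / (real n + 1)) \<longlonglongrightarrow> x"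
        using tendsto_add[OF tendsto_const LIMSEQ_inverse_real_of_nat, of x]
        by (simp add: inverse_eq_divide add.commute)
    qed (auto intro!: always_eventually less_imp_le lower upper)
    then have "filterlim (\<lambda>n. d n (J n x)) (at_right x) sequentially"
      using lower by (auto simp: filterlim_at less_imp_neq[THEN not_sym] intro!: always_eventually)
    then show "(\<lambda>n. Y (d n (J n (T (snd p)))) (fst p)) \<longlonglongrightarrow> (case p of (\<omega>, \<omega>') \<Rightarrow> Y (T \<omega>') \<omega>)"
      using cont[OF p] filterlim_compose
      unfolding continuous_within x_def split_beta by blast
  next
    fix n
    have [measurable]: "(\<lambda>p. J n (T (snd p))) \<in> A \<Otimes>\<^sub>M B \<rightarrow>\<^sub>M count_space UNIV"
      unfolding J_def by measurable
    show "(\<lambda>p. Y (d n (J n (T (snd p)))) (fst p)) \<in> borel_measurable (A \<Otimes>\<^sub>M B)"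
    proof (rule measurable_compose_countable[where f = "\<lambda>j p. Y (d n j) (fst p)"])
      show "(\<lambda>p. Y (d n j) (fst p)) \<in> borel_measurable (A \<Otimes>\<^sub>M B)" for j
        using Y[OF d0, of n j] by measurable
    qed measurable
  qed
qed

section \<open>Sigma-algebras generated by families, and transfer to image laws\<close>

text \<open>\<open>generated_events\<close> packaged as a value of type \<open>measure\<close>, so
  that measurability and products of sigma-algebras can be expressed.\<close>

definition (in prob_space) generated_algebra ::
  "'b measure \<Rightarrow> 'i set \<Rightarrow> ('i \<Rightarrow> 'a \<Rightarrow> 'b) \<Rightarrow> 'a measure" where
  "generated_algebra S I X = sigma (space M) (\<Union>i\<in>I. {X i -` A \<inter> space M | A. A \<in> sets S})"

lemma (in prob_space) space_generated_algebra [simp]: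
  "space (generated_algebra S I X) = space M"
  unfolding generated_algebra_def by (subst space_measure_of) auto

lemma (in prob_space) sets_generated_algebra:
  "sets (generated_algebra S I X) = generated_events S I X"
  unfolding generated_algebra_def generated_events_def by (subst sets_measure_of) auto

lemma (in prob_space) measurable_generated_algebra:
  assumes "i \<in> I" "space S = UNIV"
  shows "X i \<in> generated_algebra S I X \<rightarrow>\<^sub>M S"
  using assms
  by (intro measurableI) (auto simp: sets_generated_algebra generated_events_def)

lemma (in prob_space) indep_families_iff:
  "indep_families S I X T J Y \<longleftrightarrow>
     indep_set (sets (generated_algebra S I X)) (sets (generated_algebra T J Y))"
  by (simp add: indep_families_def sets_generated_algebra)

lemma has_bochner_integral_distr_iff:
  fixes f :: "'b \<Rightarrow> 'c :: {banach, second_countable_topology}"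
  assumes "g \<in> M \<rightarrow>\<^sub>M N" "f \<in> borel_measurable N"
  shows "has_bochner_integral (distr M N g) f x \<longleftrightarrow> has_bochner_integral M (\<lambda>\<omega>. f (g \<omega>)) x"
  using assms by (simp add: has_bochner_integral_iff integrable_distr_eq integral_distr)

section \<open>Moments of the Poisson process and of the process of order \<open>k\<close>\<close>

context prob_space
begin

lemma
  assumes N: "poisson_process r N" and "0 < r" "0 \<le> t"
  shows has_bochner_integral_poisson_process: "has_bochner_integral M (\<lambda>\<omega>. real (N t \<omega>)) (r * t)"
    and has_bochner_integral_poisson_process_square:
      "has_bochner_integral M (\<lambda>\<omega>. (real (N t \<omega>))\<^sup>2) (r * t + (r * t)\<^sup>2)"
proof -
  have [measurable]: "random_variable (count_space UNIV) (N t)" if "0 \<le> t" for t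
    using N that by (simp add: poisson_process_def)
  note [measurable] = this[OF \<open>0 \<le> t\<close>] this[of 0, simplified]
  have 0: "AE \<omega> in M. N 0 \<omega> = 0"
    using N by (simp add: poisson_process_def)
  \<comment> \<open>Both moments reduce to the Poisson law of \<open>N t - N 0\<close>. Time 0 is
    separate: increment laws are prescribed only for intervals of positive length, and there
    \<open>N 0 = 0\<close> almost surely decides.\<close>
  have *: "has_bochner_integral M (\<lambda>\<omega>. f (N t \<omega>)) c"
    if pos: "0 < t \<Longrightarrow> has_bochner_integral (measure_pmf (poisson_pmf (r * t))) f c"
      and zero: "t = 0 \<Longrightarrow> f 0 = c" for f :: "nat \<Rightarrow> real" and c
  proof (cases "t = 0")
    case True
    have "has_bochner_integral M (\<lambda>_. c) c"
      by (simp add: has_bochner_integral_iff prob_space)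
    then show ?thesis
      using 0 zero True
      by (subst has_bochner_integral_cong_AE[where g = "\<lambda>_. c"]) auto
  next
    case False
    then have "0 < t" using \<open>0 \<le> t\<close> by simp
    then have "distr M (count_space UNIV) (\<lambda>\<omega>. N t \<omega> - N 0 \<omega>) = measure_pmf (poisson_pmf (r * t))"
      using N by (auto simp: poisson_process_def)
    then have "has_bochner_integral (distr M (count_space UNIV) (\<lambda>\<omega>. N t \<omega> - N 0 \<omega>)) f c"
      using pos \<open>0 < t\<close> by simp
    then have "has_bochner_integral M (\<lambda>\<omega>. f (N t \<omega> - N 0 \<omega>)) c"
      by (subst (asm) has_bochner_integral_distr_iff) auto
    then show ?thesis
      using 0 by (subst (asm) has_bochner_integral_cong_AE[where g = "\<lambda>\<omega>. f (N t \<omega>)"]) auto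
  qed
  show "has_bochner_integral M (\<lambda>\<omega>. real (N t \<omega>)) (r * t)"
    using \<open>0 < r\<close> by (intro *) (auto intro!: has_bochner_integral_poisson_pmf)
  show "has_bochner_integral M (\<lambda>\<omega>. (real (N t \<omega>))\<^sup>2) (r * t + (r * t)\<^sup>2)"
    using \<open>0 < r\<close> by (intro *) (auto intro!: has_bochner_integral_poisson_pmf_square)
qed

lemma has_bochner_integral_poisson_process_mult:
  assumes N: "poisson_process r N" and "0 < r" "0 \<le> u" "u \<le> v"
  shows "has_bochner_integral M (\<lambda>\<omega>. real (N u \<omega>) * real (N v \<omega>)) (r * u + r\<^sup>2 * u * v)"
proof -
  have rv: "random_variable borel (\<lambda>\<omega>. real (N t \<omega>))" if "0 \<le> t" for t
    using N that by (auto simp: poisson_process_def)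
  have "has_bochner_integral M (\<lambda>\<omega>. real (N u \<omega>) * real (N v \<omega>))
          (r * u + (r * u)\<^sup>2 + r * u * (r * v - r * u))"
    using assms rv
    by (intro has_bochner_integral_indep_increments_mult[where X = "\<lambda>t \<omega>. real (N t \<omega>)"]
        has_bochner_integral_poisson_process has_bochner_integral_poisson_process_square)
      (auto simp: poisson_process_def)
  then show ?thesis
    by (simp add: algebra_simps power2_eq_square)
qed

lemma has_bochner_integral_indep_vars_mult:
  fixes X :: "'i \<Rightarrow> 'a \<Rightarrow> real"
  assumes "indep_vars (\<lambda>_. borel) X I" "i \<in> I" "j \<in> I" "i \<noteq> j"
    and "has_bochner_integral M (X i) a" "has_bochner_integral M (X j) b"
  shows "has_bochner_integral M (\<lambda>\<omega>. X i \<omega> * X j \<omega>) (a * b)"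
proof -
  have ind: "indep_vars (\<lambda>_. borel) X {i, j}"
    using assms by (intro indep_vars_subset[OF assms(1)]) auto
  have int: "\<And>l. l \<in> {i, j} \<Longrightarrow> integrable M (X l)"
    using assms by (auto simp: has_bochner_integral_iff)
  show ?thesis
    using indep_vars_lebesgue_integral[OF _ ind int] indep_vars_integrable[OF _ ind int] assms(4-)
    by (auto simp: has_bochner_integral_iff)
qed

text \<open>In the expanded product, diagonal pairs contribute \<open>b\<close> and independent
  off-diagonal pairs \<open>a^2\<close>. The value is linear in \<open>m\<close> and
  \<open>m * n\<close>, so once these become random only a mean and a mixed moment of the counts are
  required.\<close>

lemma has_bochner_integral_partial_sums_mult:
  fixes X :: "nat \<Rightarrow> 'a \<Rightarrow> real"
  assumes ind: "indep_vars (\<lambda>_. borel) X {1..}"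
    and X: "\<And>i. 1 \<le> i \<Longrightarrow> has_bochner_integral M (X i) a"
    and X2: "\<And>i. 1 \<le> i \<Longrightarrow> has_bochner_integral M (\<lambda>\<omega>. (X i \<omega>)\<^sup>2) b"
    and "m \<le> n"
  shows "has_bochner_integral M (\<lambda>\<omega>. (\<Sum>i=1..m. X i \<omega>) * (\<Sum>j=1..n. X j \<omega>))
           ((b - a\<^sup>2) * real m + a\<^sup>2 * (real m * real n))"
proof -
  have "has_bochner_integral M (\<lambda>\<omega>. X i \<omega> * X j \<omega>) (if i = j then b else a\<^sup>2)"
    if "1 \<le> i" "1 \<le> j" for i j
    using that has_bochner_integral_indep_vars_mult[OF ind _ _ _ X X, of i j] X2[of i]
    by (cases "i = j") (auto simp: power2_eq_square)
  then have "has_bochner_integral M (\<lambda>\<omega>. \<Sum>i=1..m. \<Sum>j=1..n. X i \<omega> * X j \<omega>)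
      (\<Sum>i=1..m. \<Sum>j=1..n. if i = j then b else a\<^sup>2)"
    by (intro has_bochner_integral_sum) auto
  then show ?thesis
    using sum_sum_diagonal[OF \<open>m \<le> n\<close>, of b "a\<^sup>2"] by (simp add: sum_product mult.assoc)
qed

text \<open>These are the facts about \<open>P\<close> that the time change uses. The mixed moment
  is given for both orders of \<open>u\<close> and \<open>v\<close>, via \<open>min u v\<close>,
  because the times later inserted are ordered only almost surely.\<close>

lemma
  assumes P: "poisson_process_order k l P" and "1 \<le> k" "0 < l"
  shows continuous_poisson_process_order:
      "\<omega> \<in> space M \<Longrightarrow> 0 \<le> u \<Longrightarrow> continuous (at_right u) (\<lambda>t. real (P t \<omega>))"
    and has_bochner_integral_poisson_process_order:
      "0 \<le> u \<Longrightarrow> has_bochner_integral M (\<lambda>\<omega>. real (P u \<omega>)) (real k * (real k + 1) / 2 * l * u)"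
    and has_bochner_integral_poisson_process_order_mult:
      "0 \<le> u \<Longrightarrow> 0 \<le> v \<Longrightarrow> has_bochner_integral M (\<lambda>\<omega>. real (P u \<omega>) * real (P v \<omega>))
         (real k * (real k + 1) * (2 * real k + 1) / 6 * l * min u v
           + (real k * (real k + 1) / 2 * l)\<^sup>2 * (u * v))"
proof -
  obtain N X where N: "poisson_process (real k * l) N"
    and X0: "\<And>\<omega>. \<omega> \<in> space M \<Longrightarrow> X 0 \<omega> = (0::nat)"
    and X: "indep_vars (\<lambda>_. count_space UNIV) X {1..}"
    and distr: "\<And>i. 1 \<le> i \<Longrightarrow> distr M (count_space UNIV) (X i) = measure_pmf (pmf_of_set {1..k})"
    and indep: "indep_families (count_space UNIV) {0..} N (count_space UNIV) {1..} X"
    and P_eq: "\<And>t \<omega>. 0 \<le> t \<Longrightarrow> \<omega> \<in> space M \<Longrightarrow> P t \<omega> = (\<Sum>i=0..N t \<omega>. X i \<omega>)"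
    using P unfolding poisson_process_order_def by blast
  define r where "r = real k * l"
  have r: "0 < r" "poisson_process r N" using assms N by (auto simp: r_def)
  \<comment> \<open>As \<open>X 0\<close> vanishes, the sum may start at 1, where the independence
    and uniformity assumptions begin.\<close>
  have P_sum: "P t \<omega> = (\<Sum>i=1..N t \<omega>. X i \<omega>)" if "0 \<le> t" "\<omega> \<in> space M" for t \<omega>
    using that X0 by (simp add: P_eq sum.atLeast_Suc_atMost)
  have X_rv [measurable]: "random_variable (count_space UNIV) (X i)" if "1 \<le> i" for i
    using X that by (auto simp: indep_vars_def2)

  show "continuous (at_right u) (\<lambda>t. real (P t \<omega>))" if "\<omega> \<in> space M" "0 \<le> u" for u \<omega>
  proof -
    have "((\<lambda>t. real (N t \<omega>)) \<longlongrightarrow> real (N u \<omega>)) (at_right u)"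
      using N that by (auto simp: poisson_process_def continuous_within)
    \<comment> \<open>Natural numbers at distance below 1 coincide, so \<open>N\<close>, and with it
      \<open>P\<close>, is constant immediately to the right of \<open>u\<close>.\<close>
    then have "\<forall>\<^sub>F t in at_right u. dist (real (N t \<omega>)) (real (N u \<omega>)) < 1"
      by (rule tendstoD) simp
    moreover have "\<forall>\<^sub>F t in at_right u. u < t"
      by (simp add: eventually_at_right_less)
    ultimately have "\<forall>\<^sub>F t in at_right u. real (P t \<omega>) = real (P u \<omega>)"
    proof eventually_elim
      case (elim t)
      then have "N t \<omega> = N u \<omega>"
        by (auto simp: dist_real_def)
      then show ?case using elim that by (simp add: P_eq)
    qed
    then show ?thesis
      unfolding continuous_within by (rule tendsto_eventually)
  qed

  define a where "a = (real k + 1) / 2"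
  define b where "b = (real k + 1) * (2 * real k + 1) / 6"
  have X_a: "has_bochner_integral M (\<lambda>\<omega>. real (X i \<omega>)) a"
    and X_b: "has_bochner_integral M (\<lambda>\<omega>. (real (X i \<omega>))\<^sup>2) b" if "1 \<le> i" for i
    using has_bochner_integral_uniform_pmf[OF \<open>1 \<le> k\<close>]
      has_bochner_integral_uniform_pmf_square[OF \<open>1 \<le> k\<close>] X_rv[OF that]
    unfolding distr[OF that, symmetric] a_def b_def
    by (simp_all add: has_bochner_integral_distr_iff)
  have X_real: "indep_vars (\<lambda>_. borel) (\<lambda>i \<omega>. real (X i \<omega>)) {1..}"
    using X by (rule indep_vars_compose2) simp
  have S_mult: "has_bochner_integral M (\<lambda>\<omega>. (\<Sum>i=1..m. real (X i \<omega>)) * (\<Sum>j=1..n. real (X j \<omega>)))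
      ((b - a\<^sup>2) * real m + a\<^sup>2 * (real m * real n))" if "m \<le> n" for m n
    using that by (intro has_bochner_integral_partial_sums_mult X_real X_a X_b)

  \<comment> \<open>The jump sizes, in \<open>F\<close>, are integrated first; the counting process,
    in \<open>G\<close>, is frozen.\<close>
  define F where "F = generated_algebra (count_space UNIV) {1..} X"
  define G where "G = generated_algebra (count_space UNIV) {0..} N"
  have FG: "indep_set (sets F) (sets G)"
    using indep unfolding F_def G_def indep_families_iff by (simp add: indep_set_commute)
  have spaces: "space F = space M" "space G = space M"
    by (simp_all add: F_def G_def)
  have X_F [measurable]: "X i \<in> F \<rightarrow>\<^sub>M count_space UNIV" if "1 \<le> i" for i
    unfolding F_def using that by (intro measurable_generated_algebra) auto
  have N_G [measurable]: "N t \<in> G \<rightarrow>\<^sub>M count_space UNIV" if "0 \<le> t" for t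
    unfolding G_def using that by (intro measurable_generated_algebra) auto
  have S_N [measurable]: "(\<lambda>(\<omega>, \<omega>'). \<Sum>i=1..N t \<omega>'. real (X i \<omega>)) \<in> borel_measurable (F \<Otimes>\<^sub>M G)"
    if "0 \<le> t" for t
    unfolding split_beta
  proof (rule measurable_compose_countable[where f = "\<lambda>n p. \<Sum>i=1..n. real (X i (fst p))"])
    show "(\<lambda>p. \<Sum>i=1..n. real (X i (fst p))) \<in> borel_measurable (F \<Otimes>\<^sub>M G)" for n
      by (rule borel_measurable_sum) (use X_F in measurable)
    show "(\<lambda>p. N t (snd p)) \<in> F \<Otimes>\<^sub>M G \<rightarrow>\<^sub>M count_space UNIV"
      using N_G[OF that] by measurable
  qed
  show "has_bochner_integral M (\<lambda>\<omega>. real (P u \<omega>)) (real k * (real k + 1) / 2 * l * u)"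
    if "0 \<le> u" for u
  proof -
    \<comment> \<open>Wald's identity: freezing the count gives \<open>N u\<close> times
      \<open>a\<close>, and \<open>r * a\<close> is the claimed rate.\<close>
    have "has_bochner_integral M (\<lambda>\<omega>. \<Sum>i=1..N u \<omega>. real (X i \<omega>)) (r * u * a)"
    proof (rule has_bochner_integral_freeze[OF FG spaces S_N[OF that]])
      show "has_bochner_integral M (\<lambda>\<omega>. \<Sum>i=1..N u \<omega>'. real (X i \<omega>)) (real (N u \<omega>') * a)" for \<omega>'
      proof -
        have "has_bochner_integral M (\<lambda>\<omega>. \<Sum>i=1..N u \<omega>'. real (X i \<omega>)) (\<Sum>i=1..N u \<omega>'. a)"
          by (intro has_bochner_integral_sum X_a) auto
        then show ?thesis by simp
      qed
      show "has_bochner_integral M (\<lambda>\<omega>. real (N u \<omega>) * a) (r * u * a)"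
        by (intro has_bochner_integral_mult_left has_bochner_integral_poisson_process[OF r(2,1) that])
    qed (simp add: sum_nonneg)
    also have "?this \<longleftrightarrow> ?thesis"
      using that by (intro has_bochner_integral_cong) (auto simp: P_sum a_def r_def)
    finally show ?thesis .
  qed

  have le: "has_bochner_integral M (\<lambda>\<omega>. real (P u \<omega>) * real (P v \<omega>))
         (real k * (real k + 1) * (2 * real k + 1) / 6 * l * u
           + (real k * (real k + 1) / 2 * l)\<^sup>2 * (u * v))" if "0 \<le> u" "u \<le> v" for u v
  proof -
    have v: "0 \<le> v" using that by simp
    \<comment> \<open>Monotonicity holds on every path, so \<open>S_mult\<close> applies to every
      frozen sample point.\<close>
    have N_le: "N u \<omega> \<le> N v \<omega>" if "\<omega> \<in> space M" for \<omega>
      using N that \<open>0 \<le> u\<close> \<open>u \<le> v\<close> by (auto simp: poisson_process_def mono_on_def)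
    \<comment> \<open>The value collapses to \<open>b * r * u + (a * r)^2 * u * v\<close>, whose
      coefficients are those of the claim.\<close>
    have "has_bochner_integral M
        (\<lambda>\<omega>. (\<Sum>i=1..N u \<omega>. real (X i \<omega>)) * (\<Sum>j=1..N v \<omega>. real (X j \<omega>)))
        ((b - a\<^sup>2) * (r * u) + a\<^sup>2 * (r * u + r\<^sup>2 * u * v))"
    proof (rule has_bochner_integral_freeze[OF FG spaces, where
          h = "\<lambda>\<omega> \<omega>'. (\<Sum>i=1..N u \<omega>'. real (X i \<omega>)) * (\<Sum>j=1..N v \<omega>'. real (X j \<omega>))"])
      show "(\<lambda>(\<omega>, \<omega>'). (\<Sum>i=1..N u \<omega>'. real (X i \<omega>)) * (\<Sum>j=1..N v \<omega>'. real (X j \<omega>)))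
          \<in> borel_measurable (F \<Otimes>\<^sub>M G)"
        using borel_measurable_times[OF S_N[OF that(1)] S_N[OF v]] by (simp add: split_beta)
      show "has_bochner_integral M
          (\<lambda>\<omega>. (\<Sum>i=1..N u \<omega>'. real (X i \<omega>)) * (\<Sum>j=1..N v \<omega>'. real (X j \<omega>)))
          ((b - a\<^sup>2) * real (N u \<omega>') + a\<^sup>2 * (real (N u \<omega>') * real (N v \<omega>')))"
        if "\<omega>' \<in> space M" for \<omega>'
        using N_le[OF that] by (rule S_mult)
      show "has_bochner_integral M
          (\<lambda>\<omega>. (b - a\<^sup>2) * real (N u \<omega>) + a\<^sup>2 * (real (N u \<omega>) * real (N v \<omega>)))
          ((b - a\<^sup>2) * (r * u) + a\<^sup>2 * (r * u + r\<^sup>2 * u * v))"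
        using r that
        by (intro has_bochner_integral_add has_bochner_integral_mult_right
            has_bochner_integral_poisson_process has_bochner_integral_poisson_process_mult) auto
    qed (simp add: sum_nonneg)
    also have "?this \<longleftrightarrow> ?thesis"
      using that v
      by (intro has_bochner_integral_cong)
        (simp_all add: P_sum a_def b_def r_def, simp add: power2_eq_square field_simps)
    finally show ?thesis .
  qed
  show "has_bochner_integral M (\<lambda>\<omega>. real (P u \<omega>) * real (P v \<omega>))
         (real k * (real k + 1) * (2 * real k + 1) / 6 * l * min u v
           + (real k * (real k + 1) / 2 * l)\<^sup>2 * (u * v))" if "0 \<le> u" "0 \<le> v" for u v
    using that le[of u v] le[of v u] by (cases "u \<le> v") (auto simp: min_def mult.commute)
qed

end

section \<open>Mean and covariance of the time-changed process\<close>

lemma (in prob_space) covariance_eq_diff: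
  assumes "has_bochner_integral M X a" "has_bochner_integral M Y b"
    and "has_bochner_integral M (\<lambda>\<omega>. X \<omega> * Y \<omega>) c"
  shows "covariance X Y = c - a * b"
proof -
  have E: "expectation X = a" "expectation Y = b"
    using assms by (auto simp: has_bochner_integral_iff)
  have "has_bochner_integral M (\<lambda>\<omega>. X \<omega> * Y \<omega> - b * X \<omega> - a * Y \<omega> + a * b)
      (c - b * a - a * b + a * b)"
    using assms
    by (intro has_bochner_integral_add has_bochner_integral_diff has_bochner_integral_mult_right)
      (auto simp: has_bochner_integral_iff prob_space)
  then show ?thesis
    by (simp add: covariance_def E has_bochner_integral_iff algebra_simps)
qed

theorem theorem3p2:
  fixes M :: "'a measure" and k :: nat and l :: real
    and f :: "real \<Rightarrow> real" and D :: "real \<Rightarrow> 'a \<Rightarrow> real"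
    and P :: "real \<Rightarrow> 'a \<Rightarrow> nat" and Q :: "real \<Rightarrow> 'a \<Rightarrow> real"
    and s t :: real
  assumes "prob_space M"
    and "k \<ge> 1" and "l > 0"
    and "prob_space.levy_subordinator M f D"
    and "\<And>\<rho> u. \<rho> > 0 \<Longrightarrow> u \<ge> 0 \<Longrightarrow> integrable M (\<lambda>\<omega>. D u \<omega> powr \<rho>)"
    and "prob_space.poisson_process_order M k l P"
    and "prob_space.indep_families M (count_space UNIV) {0..} P borel {0..} D"
    and "Q = time_changed P D"
    and "0 < s" and "s \<le> t"
  shows "prob_space.expectation M (Q t)
           = real k * (real k + 1) / 2 * l * prob_space.expectation M (D t) \<and>
         prob_space.covariance M (Q s) (Q t)
           = real k * (real k + 1) * (2 * real k + 1) / 6 * l * prob_space.expectation M (D s)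
             + (real k * (real k + 1) / 2 * l)\<^sup>2 * prob_space.variance M (D s)"
proof -
  interpret prob_space M by fact
  note P = \<open>poisson_process_order k l P\<close> \<open>1 \<le> k\<close> \<open>0 < l\<close>
  note levy = \<open>levy_subordinator f D\<close>[unfolded levy_subordinator_def levy_process_def]
  have st: "0 \<le> s" "0 \<le> t" using \<open>0 < s\<close> \<open>s \<le> t\<close> by auto
  have D_rv [measurable]: "random_variable borel (D u)" if "0 \<le> u" for u
    using levy that by simp
  have D_nonneg: "0 \<le> D u \<omega>" if "0 \<le> u" "\<omega> \<in> space M" for u \<omega>
    using levy that by simp
  have D_le: "AE \<omega> in M. D s \<omega> \<le> D t \<omega>"
  proof -
    have "AE \<omega> in M. mono_on {0..} (\<lambda>t. D t \<omega>)" using levy by blast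
    then show ?thesis
      by eventually_elim (use st \<open>s \<le> t\<close> in \<open>auto simp: mono_on_def\<close>)
  qed
  have D_int: "integrable M (D u)" "integrable M (\<lambda>\<omega>. (D u \<omega>)\<^sup>2)" if "0 \<le> u" for u
  proof -
    \<comment> \<open>Since \<open>D u\<close> is nonnegative everywhere, \<open>powr\<close> with
      exponents 1 and 2 agrees with the ordinary powers, and the moment hypothesis applies.\<close>
    have "integrable M (D u) \<longleftrightarrow> integrable M (\<lambda>\<omega>. D u \<omega> powr 1)"
      using D_nonneg[OF that] by (intro Bochner_Integration.integrable_cong) auto
    then show "integrable M (D u)" using assms(5)[of 1 u] that by simp
    have "integrable M (\<lambda>\<omega>. (D u \<omega>)\<^sup>2) \<longleftrightarrow> integrable M (\<lambda>\<omega>. D u \<omega> powr 2)"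
      using D_nonneg[OF that] by (intro Bochner_Integration.integrable_cong) (auto simp: powr_numeral)
    then show "integrable M (\<lambda>\<omega>. (D u \<omega>)\<^sup>2)" using assms(5)[of 2 u] that by simp
  qed
  define m where "m u = expectation (D u)" for u
  define m2 where "m2 = expectation (\<lambda>\<omega>. (D s \<omega>)\<^sup>2)"
  have D1: "has_bochner_integral M (D u) (m u)" if "0 \<le> u" for u
    using D_int(1)[OF that] by (simp add: m_def has_bochner_integral_iff)
  have D2: "has_bochner_integral M (\<lambda>\<omega>. (D s \<omega>)\<^sup>2) m2"
    using D_int(2)[OF st(1)] by (simp add: m2_def has_bochner_integral_iff)
  have D_mult: "has_bochner_integral M (\<lambda>\<omega>. D s \<omega> * D t \<omega>) (m2 + m s * (m t - m s))"
    using levy st \<open>s \<le> t\<close>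
    by (intro has_bochner_integral_indep_increments_mult D1 D2) auto
  \<comment> \<open>Paths of \<open>D\<close> increase only almost surely, so the minimum is
    replaced by \<open>D s\<close> under the integral and not pointwise.\<close>
  have D_min: "has_bochner_integral M (\<lambda>\<omega>. min (D s \<omega>) (D t \<omega>)) (m s)"
  proof (subst has_bochner_integral_cong_AE)
    show "AE \<omega> in M. min (D s \<omega>) (D t \<omega>) = D s \<omega>"
      using D_le by eventually_elim simp
  qed (use D_rv[OF st(1)] D_rv[OF st(2)] D1[OF st(1)] in auto)

  define \<mu> where "\<mu> = real k * (real k + 1) / 2 * l"
  define \<sigma> where "\<sigma> = real k * (real k + 1) * (2 * real k + 1) / 6 * l"
  define F where "F = generated_algebra (count_space UNIV) {0..} P"
  define G where "G = generated_algebra borel {0..} D"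
  have FG: "indep_set (sets F) (sets G)"
    using \<open>indep_families _ _ P _ _ D\<close> unfolding F_def G_def indep_families_iff .
  have spaces: "space F = space M" "space G = space M"
    by (simp_all add: F_def G_def)
  \<comment> \<open>Path and random time sit in different coordinates; right-continuity of every
    path of \<open>P\<close> makes the composition jointly measurable.\<close>
  have PD: "(\<lambda>(\<omega>, \<omega>'). real (P (D u \<omega>') \<omega>)) \<in> borel_measurable (F \<Otimes>\<^sub>M G)" if "0 \<le> u" for u
  proof (rule borel_measurable_right_continuous_time_change)
    show "(\<lambda>\<omega>. real (P v \<omega>)) \<in> borel_measurable F" if "0 \<le> v" for v
      using measurable_generated_algebra[of v "{0..}" "count_space UNIV" P] that
      unfolding F_def by simp
    show "D u \<in> borel_measurable G"
      unfolding G_def using that by (intro measurable_generated_algebra) auto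
  qed (use continuous_poisson_process_order[OF P] D_nonneg[OF that] spaces in auto)

  have Q1: "has_bochner_integral M (Q u) (\<mu> * m u)" if "0 \<le> u" for u
    unfolding \<open>Q = _\<close> time_changed_def
  proof (rule has_bochner_integral_freeze[OF FG spaces PD[OF that]])
    show "has_bochner_integral M (\<lambda>\<omega>. real (P (D u \<omega>') \<omega>)) (\<mu> * D u \<omega>')" if "\<omega>' \<in> space M" for \<omega>'
      unfolding \<mu>_def using D_nonneg[OF \<open>0 \<le> u\<close> that]
      by (rule has_bochner_integral_poisson_process_order[OF P])
  qed (use D1[OF that] in auto)
  have Q_mult: "has_bochner_integral M (\<lambda>\<omega>. Q s \<omega> * Q t \<omega>)
      (\<sigma> * m s + \<mu>\<^sup>2 * (m2 + m s * (m t - m s)))"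
    unfolding \<open>Q = _\<close> time_changed_def
  proof (rule has_bochner_integral_freeze[OF FG spaces, where
        h = "\<lambda>\<omega> \<omega>'. real (P (D s \<omega>') \<omega>) * real (P (D t \<omega>') \<omega>)"])
    show "(\<lambda>(\<omega>, \<omega>'). real (P (D s \<omega>') \<omega>) * real (P (D t \<omega>') \<omega>)) \<in> borel_measurable (F \<Otimes>\<^sub>M G)"
      using borel_measurable_times[OF PD[OF st(1)] PD[OF st(2)]] by (simp add: split_beta)
    show "has_bochner_integral M (\<lambda>\<omega>. real (P (D s \<omega>') \<omega>) * real (P (D t \<omega>') \<omega>))
        (\<sigma> * min (D s \<omega>') (D t \<omega>') + \<mu>\<^sup>2 * (D s \<omega>' * D t \<omega>'))" if "\<omega>' \<in> space M" for \<omega>'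
      unfolding \<mu>_def \<sigma>_def using D_nonneg[OF st(1) that] D_nonneg[OF st(2) that]
      by (rule has_bochner_integral_poisson_process_order_mult[OF P])
  qed (use D_min D_mult in \<open>auto intro!: has_bochner_integral_add has_bochner_integral_mult_right\<close>)

  have "variance (D s) = m2 - (m s)\<^sup>2"
    using D_int[OF st(1)] by (simp add: variance_eq m_def m2_def)
  \<comment> \<open>Subtracting \<open>\<mu> * m s * (\<mu> * m t)\<close> cancels every occurrence
    of \<open>m t\<close>, leaving the variance at the earlier time.\<close>
  moreover have "covariance (Q s) (Q t) = \<sigma> * m s + \<mu>\<^sup>2 * (m2 - (m s)\<^sup>2)"
    using covariance_eq_diff[OF Q1[OF st(1)] Q1[OF st(2)] Q_mult]
    by (simp add: algebra_simps power2_eq_square)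
  moreover have "expectation (Q t) = \<mu> * m t"
    using Q1[OF st(2)] by (simp add: has_bochner_integral_iff)
  ultimately show ?thesis
    by (simp add: \<mu>_def \<sigma>_def m_def)
qed

end
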